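(* For the Prism allied graph $\mathbb{D}^{t}_{n}$ and every $n\ge 4$, $\operatorname{mdim}(\mathbb{D}^{t}_{n})=n+1$.
   Context: For an integer $n\ge 3$, the Prism allied graph $\mathbb{D}^{t}_{n}$ has vertex set $\{p_i,q_i,r_i,s_i : 1\le i\le n\}$ and edge set $\{p_iq_i,\ p_ip_{i+1},\ q_iq_{i+1},\ r_iq_i,\ r_iq_{i+1},\ r_is_i : 1\le i\le n\}$, with indices taken modulo $n$. For a connected graph $H$, $d_H(u,v)$ is the shortest-path distance, and for a vertex $x$ and an edge $e=uv$, $d_H(x,e)=\min\{d_H(x,u),d_H(x,v)\}$. A set $M\subseteq V(H)$ is a mixed metric generator of $H$ if for every two distinct elements $y_1,y_2\in V(H)\cup E(H)$ there is a vertex $z\in M$ with $d_H(z,y_1)\ne d_H(z,y_2)$. The mixed metric dimension $\operatorname{mdim}(H)$ is the minimum cardinality of a mixed metric generator of $H$. *)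

theory Defs
  imports Main
begin

(* A finite simple graph is given by its vertex set V and its edge set E, an edge being the
   two-element set of its endpoints. *)

definition walk_betw :: "'v set \<Rightarrow> 'v set set \<Rightarrow> 'v \<Rightarrow> 'v list \<Rightarrow> 'v \<Rightarrow> bool" where
  "walk_betw V E u xs v \<longleftrightarrow>
     xs \<noteq> [] \<and> hd xs = u \<and> last xs = v \<and> set xs \<subseteq> V \<and>
     (\<forall>i. Suc i < length xs \<longrightarrow> {xs ! i, xs ! Suc i} \<in> E)"

(* A walk with vertex list xs has length xs - 1 edges. The value is only meaningful
   when u and v lie in the same connected component. *)
definition gdist :: "'v set \<Rightarrow> 'v set set \<Rightarrow> 'v \<Rightarrow> 'v \<Rightarrow> nat" where
  "gdist V E u v = (LEAST k. \<exists>xs. walk_betw V E u xs v \<and> length xs = Suc k)"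

definition edge_dist :: "'v set \<Rightarrow> 'v set set \<Rightarrow> 'v \<Rightarrow> 'v set \<Rightarrow> nat" where
  "edge_dist V E x e = Min (gdist V E x ` e)"

(* Vertices and edges together, as a disjoint union: Inl v is a vertex, Inr e an edge. *)
definition elements :: "'v set \<Rightarrow> 'v set set \<Rightarrow> ('v + 'v set) set" where
  "elements V E = Inl ` V \<union> Inr ` E"

fun elem_dist :: "'v set \<Rightarrow> 'v set set \<Rightarrow> 'v \<Rightarrow> 'v + 'v set \<Rightarrow> nat" where
  "elem_dist V E x (Inl v) = gdist V E x v"
| "elem_dist V E x (Inr e) = edge_dist V E x e"

definition mixed_metric_generator :: "'v set \<Rightarrow> 'v set set \<Rightarrow> 'v set \<Rightarrow> bool" where
  "mixed_metric_generator V E M \<longleftrightarrow>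
     M \<subseteq> V \<and>
     (\<forall>y1\<in>elements V E. \<forall>y2\<in>elements V E. y1 \<noteq> y2 \<longrightarrow>
        (\<exists>z\<in>M. elem_dist V E z y1 \<noteq> elem_dist V E z y2))"

definition mdim :: "'v set \<Rightarrow> 'v set set \<Rightarrow> nat" where
  "mdim V E = (LEAST k. \<exists>M. mixed_metric_generator V E M \<and> finite M \<and> card M = k)"

datatype prism_vertex = P nat | Q nat | R nat | S nat

definition prism_allied_verts :: "nat \<Rightarrow> prism_vertex set" where
  "prism_allied_verts n = (\<Union>i\<in>{1..n}. {P i, Q i, R i, S i})"

(* The cyclic successor of i in {1..n} is i mod n + 1. *)
definition prism_allied_edges :: "nat \<Rightarrow> prism_vertex set set" where
  "prism_allied_edges n =
     (\<Union>i\<in>{1..n}. {{P i, Q i}, {P i, P (i mod n + 1)}, {Q i, Q (i mod n + 1)},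
                     {R i, Q i}, {R i, Q (i mod n + 1)}, {R i, S i}})"

end

theory Submission
  imports Defs
begin

text \<open>
  Every pendant vertex \<open>S i\<close> lies in each mixed metric generator, because no other vertex tells
  \<open>R i\<close> from the edge \<open>R i S i\<close>. The \<open>n\<close> pendant vertices alone do not suffice: they see \<open>P i\<close>
  only through the \<open>Q\<close>-cycle, so none of them tells \<open>Q i\<close> from \<open>P i Q i\<close>. Conversely, the set of
  those \<open>j\<close> for which \<open>S j\<close> has distance at most \<open>k\<close> from an element, for \<open>k = 0, 1, 2, 3\<close>,
  identifies that element up to this one ambiguity, and \<open>P 1\<close> resolves it since it is closer to
  \<open>P i\<close> than to \<open>Q i\<close>.
\<close>

section \<open>Distances and mixed metric generators\<close>

lemma walk_betw_snocI:
  assumes "walk_betw V E u xs w" "{w, v} \<in> E" "v \<in> V"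
  shows "walk_betw V E u (xs @ [v]) v"
  using assms unfolding walk_betw_def
  by (auto simp: nth_append last_conv_nth less_Suc_eq not_less_eq) (metis diff_Suc_Suc diff_zero)

lemma walk_betw_snocD:
  assumes "walk_betw V E u (xs @ [v]) w" "xs \<noteq> []"
  shows "w = v" "walk_betw V E u xs (last xs)" "{last xs, v} \<in> E"
proof -
  have edge: "{(xs @ [v]) ! i, (xs @ [v]) ! Suc i} \<in> E" if "Suc i < Suc (length xs)" for i
    using assms(1) that unfolding walk_betw_def by (metis length_append_singleton)
  show "w = v" using assms unfolding walk_betw_def by simp
  have "{xs ! i, xs ! Suc i} \<in> E" if "Suc i < length xs" for i
    using edge[of i] that by (simp add: nth_append)
  then show "walk_betw V E u xs (last xs)"
    using assms unfolding walk_betw_def by auto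
  show "{last xs, v} \<in> E"
    using edge[of "length xs - 1"] assms(2) by (simp add: nth_append last_conv_nth)
qed

text \<open>Reduces connectedness to a reachability relation, for which no vertex list has to be
  exhibited.\<close>

lemma rtrancl_imp_walk_betw:
  assumes "(u, v) \<in> {(a, b). {a, b} \<in> E \<and> b \<in> V}\<^sup>*" "u \<in> V"
  shows "\<exists>xs. walk_betw V E u xs v"
  using assms
proof (induction rule: rtrancl_induct)
  case base
  then have "walk_betw V E u [u] u" by (simp add: walk_betw_def)
  then show ?case by blast
next
  case (step w v)
  then show ?case using walk_betw_snocI by fastforce
qed

text \<open>The existence of a walk makes the \<open>LEAST\<close> in \<open>gdist\<close> attained.
  The form \<open>\<le> k\<close> turns distances into balls, which suits induction on the
  radius.\<close>

lemma gdist_le_iff: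
  assumes "\<exists>xs. walk_betw V E u xs v"
  shows "gdist V E u v \<le> k \<longleftrightarrow> (\<exists>xs. walk_betw V E u xs v \<and> length xs \<le> Suc k)"
proof
  have "\<exists>k xs. walk_betw V E u xs v \<and> length xs = Suc k"
    using assms unfolding walk_betw_def by (metis length_Suc_conv neq_Nil_conv)
  then have "\<exists>xs. walk_betw V E u xs v \<and> length xs = Suc (gdist V E u v)"
    unfolding gdist_def by (rule LeastI_ex)
  then show "gdist V E u v \<le> k \<Longrightarrow> \<exists>xs. walk_betw V E u xs v \<and> length xs \<le> Suc k" by auto
next
  assume "\<exists>xs. walk_betw V E u xs v \<and> length xs \<le> Suc k"
  then obtain xs where xs: "walk_betw V E u xs v" "length xs \<le> Suc k" by blast
  then obtain l where "length xs = Suc l"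
    unfolding walk_betw_def by (metis length_Suc_conv neq_Nil_conv)
  with xs show "gdist V E u v \<le> k"
    unfolding gdist_def by (intro order_trans[OF Least_le[of _ l]]) auto
qed

lemma gdist_le_0_iff:
  assumes "\<exists>xs. walk_betw V E u xs v" "u \<in> V"
  shows "gdist V E u v \<le> 0 \<longleftrightarrow> u = v"
proof -
  have "walk_betw V E u xs v \<and> length xs \<le> 1 \<longleftrightarrow> xs = [u] \<and> u = v" for xs
    using assms(2) unfolding walk_betw_def by (cases xs) auto
  with gdist_le_iff[OF assms(1), of 0] show ?thesis by (metis One_nat_def)
qed

text \<open>One step of breadth-first search: deleting the last vertex of a walk leaves a walk to a
  neighbour of \<open>v\<close>, and appending \<open>v\<close> reverses this.\<close>

lemma gdist_le_Suc_iff: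
  assumes conn: "\<And>w. w \<in> V \<Longrightarrow> \<exists>xs. walk_betw V E u xs w"
    and "u \<in> V" "v \<in> V"
  shows "gdist V E u v \<le> Suc k \<longleftrightarrow>
    gdist V E u v \<le> k \<or> (\<exists>w\<in>V. {w, v} \<in> E \<and> gdist V E u w \<le> k)"
proof (intro iffI; (elim disjE bexE conjE)?)
  assume "gdist V E u v \<le> Suc k"
  then obtain xs where xs: "walk_betw V E u xs v" "length xs \<le> Suc (Suc k)"
    using gdist_le_iff[OF conn] \<open>v \<in> V\<close> by blast
  then obtain ys x where ys: "xs = ys @ [x]"
    unfolding walk_betw_def by (metis rev_exhaust)
  show "gdist V E u v \<le> k \<or> (\<exists>w\<in>V. {w, v} \<in> E \<and> gdist V E u w \<le> k)"
  \<comment> \<open>A one-vertex walk has no predecessor to cut back to; it forces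
    \<open>u = v\<close>, which lies in every ball.\<close>
  proof (cases "ys = []")
    case True
    then have "u = v" using xs ys unfolding walk_betw_def by auto
    then have "gdist V E u v \<le> 0" using gdist_le_0_iff[OF conn[OF \<open>v \<in> V\<close>]] \<open>u \<in> V\<close> by simp
    then show ?thesis by simp
  next
    case False
    have w: "walk_betw V E u ys (last ys)" "{last ys, v} \<in> E"
      using walk_betw_snocD[OF xs(1)[unfolded ys] False] by auto
    then have V: "last ys \<in> V" using False unfolding walk_betw_def by auto
    have "length ys \<le> Suc k" using xs ys by simp
    then have "gdist V E u (last ys) \<le> k"
      using gdist_le_iff[OF conn[OF V]] w(1) by blast
    then show ?thesis using w V by blast
  qed
next
  fix w assume w: "w \<in> V" "{w, v} \<in> E" "gdist V E u w \<le> k"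
  then obtain xs where "walk_betw V E u xs w" "length xs \<le> Suc k"
    using gdist_le_iff[OF conn] by blast
  then have "walk_betw V E u (xs @ [v]) v" "length (xs @ [v]) \<le> Suc (Suc k)"
    using walk_betw_snocI w \<open>v \<in> V\<close> by fastforce+
  then show "gdist V E u v \<le> Suc k"
    using gdist_le_iff[OF conn] \<open>v \<in> V\<close> by blast
qed simp

lemma edge_dist_doubleton: "edge_dist V E x {a, b} = min (gdist V E x a) (gdist V E x b)"
  by (simp add: edge_dist_def)

lemma mixed_metric_generatorD:
  assumes "mixed_metric_generator V E M" "v \<in> V" "e \<in> E"
  shows "\<exists>z\<in>M. gdist V E z v \<noteq> edge_dist V E z e"
proof -
  have "Inl v \<in> elements V E" "Inr e \<in> elements V E" "Inl v \<noteq> Inr e"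
    using assms by (auto simp: elements_def)
  then show ?thesis using assms(1) unfolding mixed_metric_generator_def
    by (metis elem_dist.simps)
qed

section \<open>The prism allied graph\<close>

locale prism_allied =
  fixes n :: nat
  assumes n_ge_4: "n \<ge> 4"
begin

section \<open>Cyclic index arithmetic\<close>

definition "I = {1..n}"
abbreviation "V \<equiv> prism_allied_verts n"
abbreviation "E \<equiv> prism_allied_edges n"
abbreviation "d \<equiv> gdist V E"

text \<open>Case distinctions in place of \<open>mod\<close> keep the wrap-around within reach of
  linear arithmetic; \<open>mod_eq_nx\<close> links back to the edge set.\<close>

definition nx :: "nat \<Rightarrow> nat" where "nx i = (if i = n then 1 else i + 1)"
definition pv :: "nat \<Rightarrow> nat" where "pv i = (if i = 1 then n else i - 1)"

lemma mod_eq_nx: "i \<in> I \<Longrightarrow> i mod n + 1 = nx i"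
  using n_ge_4 by (cases "i = n") (auto simp: nx_def I_def)

lemma nx_in [simp]: "i \<in> I \<Longrightarrow> nx i \<in> I"
  and pv_in [simp]: "i \<in> I \<Longrightarrow> pv i \<in> I"
  and nx_pv [simp]: "i \<in> I \<Longrightarrow> nx (pv i) = i"
  and pv_nx [simp]: "i \<in> I \<Longrightarrow> pv (nx i) = i"
  using n_ge_4 by (auto simp: I_def nx_def pv_def)

lemma cyclic_distinct:
  assumes "i \<in> I"
  shows "nx i \<noteq> i" "pv i \<noteq> i" "nx i \<noteq> pv i"
  using assms n_ge_4 by (auto simp: I_def nx_def pv_def)

text \<open>The only other match would be \<open>pv i = j\<close> and \<open>pv j = i\<close>, a
  cycle of length two.\<close>

lemma pair_inj:
  assumes "i \<in> I" "j \<in> I" "{pv i, i} = {pv j, j}"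
  shows "i = j"
  using assms n_ge_4 by (auto simp: doubleton_eq_iff pv_def I_def split: if_splits)

text \<open>For \<open>n = 3\<close> every such triple is all of \<open>I\<close>. For
  \<open>n \<ge> 4\<close> three consecutive indices form a proper arc, which has a unique middle
  element.\<close>

lemma triple_inj:
  assumes "i \<in> I" "j \<in> I" "{pv i, i, nx i} = {pv j, j, nx j}"
  shows "i = j"
proof -
  have "j \<in> {pv i, i, nx i}" "nx j \<in> {pv i, i, nx i}" "pv j \<in> {pv i, i, nx i}"
    using assms(3) by blast+
  then show ?thesis using assms(1,2) n_ge_4
    by (auto simp: nx_def pv_def I_def split: if_splits)
qed

text \<open>Arbitrary \<open>a\<close> and \<open>b\<close> cover pairs at any two indices, so no
  index comparison is needed to tell pairs from triples.\<close>

lemma pair_neq_triple: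
  assumes "j \<in> I"
  shows "{a, b} \<noteq> {pv j, j, nx j}"
proof
  assume "{a, b} = {pv j, j, nx j}"
  then have "card {pv j, j, nx j} = card {a, b}" by simp
  moreover have "card {pv j, j, nx j} = 3" using cyclic_distinct[OF assms] by fastforce
  moreover have "card {a, b} \<le> 2" by (simp add: card_insert_if)
  ultimately show False by linarith
qed

section \<open>Adjacency, neighbourhoods and connectedness\<close>

lemma V_iff [simp]:
  "P i \<in> V \<longleftrightarrow> i \<in> I" "Q i \<in> V \<longleftrightarrow> i \<in> I" "R i \<in> V \<longleftrightarrow> i \<in> I" "S i \<in> V \<longleftrightarrow> i \<in> I"
  by (auto simp: prism_allied_verts_def I_def)

lemma E_eq: "E = (\<Union>i\<in>I. {{P i, Q i}, {P i, P (nx i)}, {Q i, Q (nx i)},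
    {R i, Q i}, {R i, Q (nx i)}, {R i, S i}})"
  unfolding prism_allied_edges_def by (rule SUP_cong) (simp only: I_def, simp only: mod_eq_nx)

lemma edge_iff:
  "{P i, P j} \<in> E \<longleftrightarrow> i \<in> I \<and> j = nx i \<or> j \<in> I \<and> i = nx j"
  "{Q i, Q j} \<in> E \<longleftrightarrow> i \<in> I \<and> j = nx i \<or> j \<in> I \<and> i = nx j"
  "{P i, Q j} \<in> E \<longleftrightarrow> i \<in> I \<and> j = i" "{Q j, P i} \<in> E \<longleftrightarrow> i \<in> I \<and> j = i"
  "{R i, Q j} \<in> E \<longleftrightarrow> i \<in> I \<and> (j = i \<or> j = nx i)"
  "{Q j, R i} \<in> E \<longleftrightarrow> i \<in> I \<and> (j = i \<or> j = nx i)"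
  "{R i, S j} \<in> E \<longleftrightarrow> i \<in> I \<and> j = i" "{S j, R i} \<in> E \<longleftrightarrow> i \<in> I \<and> j = i"
  "{P i, R j} \<notin> E" "{R j, P i} \<notin> E" "{P i, S j} \<notin> E" "{S j, P i} \<notin> E"
  "{Q i, S j} \<notin> E" "{S j, Q i} \<notin> E" "{R i, R j} \<notin> E" "{S i, S j} \<notin> E"
  by (auto simp: E_eq doubleton_eq_iff)

text \<open>The left side is the conjunction bracketed in \<open>d_le_Suc\<close>, so the
  neighbourhood lemmas turn its existential into a finite disjunction.\<close>

lemma nbr_P: "i \<in> I \<Longrightarrow> w \<in> V \<and> {w, P i} \<in> E \<longleftrightarrow> w \<in> {Q i, P (nx i), P (pv i)}"
  by (cases w) (auto simp: edge_iff)

lemma nbr_Q: "i \<in> I \<Longrightarrow> w \<in> V \<and> {w, Q i} \<in> E \<longleftrightarrow>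
    w \<in> {P i, Q (nx i), Q (pv i), R i, R (pv i)}"
  by (cases w) (auto simp: edge_iff)

lemma nbr_R: "i \<in> I \<Longrightarrow> w \<in> V \<and> {w, R i} \<in> E \<longleftrightarrow> w \<in> {Q i, Q (nx i), S i}"
  by (cases w) (auto simp: edge_iff)

lemma nbr_S: "i \<in> I \<Longrightarrow> w \<in> V \<and> {w, S i} \<in> E \<longleftrightarrow> w = R i"
  by (cases w) (auto simp: edge_iff)

text \<open>Every vertex reaches \<open>P 1\<close>: \<open>S i\<close>, \<open>R i\<close>,
  \<open>Q i\<close>, \<open>P i\<close> are successively adjacent, and the \<open>P\<close>-cycle
  is descended index by index. Symmetry then joins any two vertices.\<close>

lemma connected:
  assumes "u \<in> V" "v \<in> V"
  shows "\<exists>xs. walk_betw V E u xs v"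
proof (rule rtrancl_imp_walk_betw[OF _ assms(1)])
  \<comment> \<open>Requiring both endpoints in \<open>V\<close> makes \<open>r\<close> symmetric;
    it is contained in the relation of the goal.\<close>
  define r where "r = {(a, b). {a, b} \<in> E \<and> a \<in> V \<and> b \<in> V}"
  have "sym r" by (auto simp: r_def sym_def insert_commute)
  then have sym: "(a, b) \<in> r\<^sup>* \<Longrightarrow> (b, a) \<in> r\<^sup>*" for a b
    by (meson sym_rtrancl symD)
  have P: "i \<in> I \<longrightarrow> (P i, P 1) \<in> r\<^sup>*" for i
  proof (induction i)
    case (Suc i)
    show ?case
    proof (cases "i = 0")
      case False
      show ?thesis
      proof
        assume "Suc i \<in> I"
        then have "pv (Suc i) = i" "i \<in> I" using False by (auto simp: pv_def I_def)
        then have "(P (Suc i), P i) \<in> r"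
          using nbr_P[of "Suc i" "P i"] \<open>Suc i \<in> I\<close> by (auto simp: r_def insert_commute)
        with Suc \<open>i \<in> I\<close> show "(P (Suc i), P 1) \<in> r\<^sup>*"
          by (meson converse_rtrancl_into_rtrancl)
      qed
    qed simp
  qed (simp add: I_def)
  have "(w, P 1) \<in> r\<^sup>*" if "w \<in> V" for w
  proof -
    have Q: "(Q i, P 1) \<in> r\<^sup>*" if "i \<in> I" for i
    proof -
      have "(Q i, P i) \<in> r" using nbr_P[of i "Q i"] that by (auto simp: r_def)
      then show ?thesis using P that by (meson converse_rtrancl_into_rtrancl)
    qed
    have R: "(R i, P 1) \<in> r\<^sup>*" if "i \<in> I" for i
    proof -
      have "(R i, Q i) \<in> r" using nbr_Q[of i "R i"] that by (auto simp: r_def)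
      then show ?thesis using Q that by (meson converse_rtrancl_into_rtrancl)
    qed
    have S: "(S i, P 1) \<in> r\<^sup>*" if "i \<in> I" for i
    proof -
      have "(S i, R i) \<in> r" using nbr_R[of i "S i"] that by (auto simp: r_def)
      then show ?thesis using R that by (meson converse_rtrancl_into_rtrancl)
    qed
    show ?thesis using that P Q R S by (cases w) auto
  qed
  then have "(u, v) \<in> r\<^sup>*" using assms sym by (meson rtrancl_trans)
  then show "(u, v) \<in> {(a, b). {a, b} \<in> E \<and> b \<in> V}\<^sup>*"
    by (rule rev_subsetD[OF _ rtrancl_mono]) (auto simp: r_def)
qed

section \<open>Recursion for balls around a vertex\<close>

lemma d_le_0: "u \<in> V \<Longrightarrow> v \<in> V \<Longrightarrow> d u v \<le> 0 \<longleftrightarrow> u = v"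
  by (rule gdist_le_0_iff) (rule connected)

lemma d_le_Suc:
  assumes "u \<in> V" "v \<in> V"
  shows "d u v \<le> Suc k \<longleftrightarrow> d u v \<le> k \<or> (\<exists>w. (w \<in> V \<and> {w, v} \<in> E) \<and> d u w \<le> k)"
  using gdist_le_Suc_iff[OF connected[OF assms(1)] assms] by blast

text \<open>All distance facts below come from this recursion on the radius; no closed distance
  formula is used.\<close>

lemma d_le_Suc_cases:
  assumes "u \<in> V" "i \<in> I"
  shows "d u (P i) \<le> Suc k \<longleftrightarrow>
      d u (P i) \<le> k \<or> d u (Q i) \<le> k \<or> d u (P (nx i)) \<le> k \<or> d u (P (pv i)) \<le> k"
    and "d u (Q i) \<le> Suc k \<longleftrightarrow>
      d u (Q i) \<le> k \<or> d u (P i) \<le> k \<or> d u (Q (nx i)) \<le> k \<or> d u (Q (pv i)) \<le> k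
      \<or> d u (R i) \<le> k \<or> d u (R (pv i)) \<le> k"
    and "d u (R i) \<le> Suc k \<longleftrightarrow>
      d u (R i) \<le> k \<or> d u (Q i) \<le> k \<or> d u (Q (nx i)) \<le> k \<or> d u (S i) \<le> k"
    and "d u (S i) \<le> Suc k \<longleftrightarrow> d u (S i) \<le> k \<or> d u (R i) \<le> k"
proof -
  have V: "P i \<in> V" "Q i \<in> V" "R i \<in> V" "S i \<in> V" using assms(2) by simp_all
  show "d u (P i) \<le> Suc k \<longleftrightarrow>
      d u (P i) \<le> k \<or> d u (Q i) \<le> k \<or> d u (P (nx i)) \<le> k \<or> d u (P (pv i)) \<le> k"
    unfolding d_le_Suc[OF assms(1) V(1)] nbr_P[OF assms(2)] by blast
  show "d u (Q i) \<le> Suc k \<longleftrightarrow>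
      d u (Q i) \<le> k \<or> d u (P i) \<le> k \<or> d u (Q (nx i)) \<le> k \<or> d u (Q (pv i)) \<le> k
      \<or> d u (R i) \<le> k \<or> d u (R (pv i)) \<le> k"
    unfolding d_le_Suc[OF assms(1) V(2)] nbr_Q[OF assms(2)] by blast
  show "d u (R i) \<le> Suc k \<longleftrightarrow>
      d u (R i) \<le> k \<or> d u (Q i) \<le> k \<or> d u (Q (nx i)) \<le> k \<or> d u (S i) \<le> k"
    unfolding d_le_Suc[OF assms(1) V(3)] nbr_R[OF assms(2)] by blast
  show "d u (S i) \<le> Suc k \<longleftrightarrow> d u (S i) \<le> k \<or> d u (R i) \<le> k"
    unfolding d_le_Suc[OF assms(1) V(4)] nbr_S[OF assms(2)] by blast
qed

section \<open>Lower bound\<close>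

text \<open>\<open>S i\<close> is a leaf at \<open>R i\<close>, so any walk arriving there from
  elsewhere passes through \<open>R i\<close>.\<close>

lemma R_le_S:
  assumes "z \<in> V" "i \<in> I" "z \<noteq> S i"
  shows "d z (R i) \<le> d z (S i)"
proof (cases "d z (S i)")
  case 0
  then show ?thesis using d_le_0[of z "S i"] assms by simp
next
  case (Suc k)
  then show ?thesis using d_le_Suc_cases(4)[OF assms(1,2), of k] by simp
qed

lemma S_in_generator:
  assumes "mixed_metric_generator V E M" "i \<in> I"
  shows "S i \<in> M"
proof (rule ccontr)
  assume "S i \<notin> M"
  have "R i \<in> V" "{R i, S i} \<in> E" using assms(2) by (auto simp: E_eq)
  from mixed_metric_generatorD[OF assms(1) this] obtain z
    where z: "z \<in> M" "d z (R i) \<noteq> min (d z (R i)) (d z (S i))"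
    by (auto simp: edge_dist_doubleton)
  have "z \<in> V" using z assms(1) by (auto simp: mixed_metric_generator_def)
  then show False using R_le_S[of z i] assms(2) z \<open>S i \<notin> M\<close> by (cases "z = S i") auto
qed

text \<open>Walks from \<open>S j\<close> reach the \<open>P\<close>-cycle only through the
  \<open>Q\<close>-cycle, and steps along the \<open>P\<close>-cycle can be copied along the
  \<open>Q\<close>-cycle.\<close>

lemma S_Q_le_S_P:
  assumes "j \<in> I"
  shows "i \<in> I \<Longrightarrow> d (S j) (Q i) \<le> d (S j) (P i)"
proof -
  have S: "S j \<in> V" using assms by simp
  \<comment> \<open>Induction on the radius for all \<open>i\<close> at once, since the recursion
    moves to the neighbouring indices.\<close>
  have "\<forall>i\<in>I. d (S j) (P i) \<le> k \<longrightarrow> d (S j) (Q i) \<le> k" for k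
  proof (induction k)
    case 0
    then show ?case using d_le_0[OF S] by auto
  next
    case (Suc k)
    show ?case
    proof (intro ballI impI)
      fix i assume i: "i \<in> I" and "d (S j) (P i) \<le> Suc k"
      then consider "d (S j) (P i) \<le> k" | "d (S j) (Q i) \<le> k"
        | "d (S j) (P (nx i)) \<le> k" | "d (S j) (P (pv i)) \<le> k"
        using d_le_Suc_cases(1)[OF S i, of k] by blast
      then show "d (S j) (Q i) \<le> Suc k"
        using Suc.IH i nx_in[OF i] pv_in[OF i] d_le_Suc_cases(2)[OF S i, of k] by cases blast+
    qed
  qed
  then show "i \<in> I \<Longrightarrow> d (S j) (Q i) \<le> d (S j) (P i)" by blast
qed

lemma card_S: "card (S ` I) = n"
  by (subst card_image) (auto simp: inj_on_def I_def)

lemma generator_card: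
  assumes "mixed_metric_generator V E M" "finite M"
  shows "n + 1 \<le> card M"
proof -
  have sub: "S ` I \<subseteq> M" using S_in_generator[OF assms(1)] by blast
  have "1 \<in> I" using n_ge_4 by (simp add: I_def)
  then have "Q 1 \<in> V" "{P 1, Q 1} \<in> E" by (auto simp: E_eq)
  from mixed_metric_generatorD[OF assms(1) this] obtain z
    where z: "z \<in> M" "d z (Q 1) \<noteq> min (d z (P 1)) (d z (Q 1))"
    by (auto simp: edge_dist_doubleton)
  \<comment> \<open>Seen from any pendant vertex the minimum is attained at \<open>Q 1\<close>, so
    \<open>z\<close> is an additional member of \<open>M\<close>.\<close>
  then have "z \<notin> S ` I" using S_Q_le_S_P[OF _ \<open>1 \<in> I\<close>] by (auto simp: min_absorb2)
  with sub z(1) have "S ` I \<subset> M" by blast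
  from psubset_card_mono[OF assms(2) this] show ?thesis by (simp add: card_S)
qed

section \<open>Upper bound\<close>

text \<open>Projecting a walk from \<open>P j\<close> onto the \<open>P\<close>-cycle saves the step
  that leaves this cycle.\<close>

lemma P_P_less_P_Q:
  assumes "j \<in> I" "i \<in> I"
  shows "d (P j) (P i) < d (P j) (Q i)"
proof -
  have Pj: "P j \<in> V" using assms by simp
  note step = d_le_Suc_cases[OF Pj]
  \<comment> \<open>Walks may detour through \<open>R i\<close>, which joins \<open>Q i\<close> to
    \<open>Q (nx i)\<close>; hence the invariant bounds both \<open>P i\<close> and
    \<open>P (nx i)\<close> there. \<open>S i\<close> is included because it is a neighbour of
    \<open>R i\<close>.\<close>
  have "\<forall>i\<in>I. (d (P j) (Q i) \<le> k \<longrightarrow> d (P j) (P i) < k) \<and>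
    (d (P j) (R i) \<le> k \<or> d (P j) (S i) \<le> k \<longrightarrow>
      d (P j) (P i) < k \<and> d (P j) (P (nx i)) < k)" for k
  proof (induction k)
    case 0
    then show ?case using d_le_0[OF Pj] by auto
  next
    case (Suc k)
    have IH_Q: "d (P j) (P i) < k" if "i \<in> I" "d (P j) (Q i) \<le> k" for i
      using Suc.IH that by blast
    have IH_RS: "d (P j) (P i) < k" "d (P j) (P (nx i)) < k"
      if "i \<in> I" "d (P j) (R i) \<le> k \<or> d (P j) (S i) \<le> k" for i
      using Suc.IH that by blast+
    have PP: "d (P j) (P i) \<le> Suc l"
      if "i \<in> I" "d (P j) (P (nx i)) \<le> l \<or> d (P j) (P (pv i)) \<le> l" for i l
      using step(1) that by blast
    \<comment> \<open>The strict bound leaves room for one step along the cycle; for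
      \<open>k = 0\<close> the premise is false.\<close>
    have PP': "d (P j) (P i) \<le> k"
      if "i \<in> I" "d (P j) (P (nx i)) < k \<or> d (P j) (P (pv i)) < k" for i
      using PP[of i "k - 1"] that by (cases k) auto
    show ?case
    proof
      fix i assume i: "i \<in> I"
      note ii = i nx_in[OF i] pv_in[OF i]
      have q: "d (P j) (P i) < Suc k" if le: "d (P j) (Q i) \<le> Suc k"
      proof -
        consider "d (P j) (Q i) \<le> k" | "d (P j) (P i) \<le> k" | "d (P j) (Q (nx i)) \<le> k"
          | "d (P j) (Q (pv i)) \<le> k" | "d (P j) (R i) \<le> k" | "d (P j) (R (pv i)) \<le> k"
          using step(2)[OF i, of k] le by blast
        then show ?thesis
        proof cases
          case 1 then show ?thesis using IH_Q[OF i] by simp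
        next
          case 2 then show ?thesis by simp
        next
          case 3 then show ?thesis using IH_Q[OF ii(2)] PP'[OF i] by simp
        next
          case 4 then show ?thesis using IH_Q[OF ii(3)] PP'[OF i] by simp
        next
          case 5 then show ?thesis using IH_RS(1)[OF i] by simp
        next
          case 6 then show ?thesis using IH_RS(2)[OF ii(3)] i by simp
        qed
      qed
      have r: "d (P j) (P i) < Suc k \<and> d (P j) (P (nx i)) < Suc k"
        if le: "d (P j) (R i) \<le> Suc k \<or> d (P j) (S i) \<le> Suc k"
      proof -
        consider "d (P j) (R i) \<le> k \<or> d (P j) (S i) \<le> k"
          | "d (P j) (Q i) \<le> k" | "d (P j) (Q (nx i)) \<le> k"
          using step(3,4)[OF i, of k] le by blast
        then show ?thesis
        proof cases
          case 1
          then show ?thesis using IH_RS[OF i] by simp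
        next
          case 2
          then have "d (P j) (P i) < k" by (rule IH_Q[OF i])
          then show ?thesis using PP'[of "nx i"] ii pv_nx[OF i] by simp
        next
          case 3
          then have "d (P j) (P (nx i)) < k" by (rule IH_Q[OF ii(2)])
          then show ?thesis using PP'[of i] i by simp
        qed
      qed
      from q r show "(d (P j) (Q i) \<le> Suc k \<longrightarrow> d (P j) (P i) < Suc k) \<and>
        (d (P j) (R i) \<le> Suc k \<or> d (P j) (S i) \<le> Suc k \<longrightarrow>
          d (P j) (P i) < Suc k \<and> d (P j) (P (nx i)) < Suc k)" by blast
    qed
  qed
  \<comment> \<open>The radius is taken to be \<open>d (P j) (Q i)\<close> itself.\<close>
  then show ?thesis using assms(2) by blast
qed

text \<open>These sets, over all \<open>k\<close>, encode the vector of distances from the pendant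
  vertices. In this form both the minimum over an edge and the ball recursion become unions.\<close>

definition near :: "nat \<Rightarrow> prism_vertex + prism_vertex set \<Rightarrow> nat set" where
  "near k y = {j\<in>I. elem_dist V E (S j) y \<le> k}"

lemma near_edge: "near k (Inr {a, b}) = near k (Inl a) \<union> near k (Inl b)"
  by (auto simp: near_def edge_dist_doubleton)

lemma near_0:
  assumes "i \<in> I"
  shows "near 0 (Inl (P i)) = {}" "near 0 (Inl (Q i)) = {}"
    "near 0 (Inl (R i)) = {}" "near 0 (Inl (S i)) = {i}"
  using assms by (auto simp: near_def d_le_0[simplified] simp del: neq0_conv)

lemma near_Suc:
  assumes "i \<in> I"
  shows "near (Suc k) (Inl (P i)) = near k (Inl (P i)) \<union> near k (Inl (Q i))
      \<union> near k (Inl (P (nx i))) \<union> near k (Inl (P (pv i)))"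
    and "near (Suc k) (Inl (Q i)) = near k (Inl (Q i)) \<union> near k (Inl (P i))
      \<union> near k (Inl (Q (nx i))) \<union> near k (Inl (Q (pv i)))
      \<union> near k (Inl (R i)) \<union> near k (Inl (R (pv i)))"
    and "near (Suc k) (Inl (R i)) = near k (Inl (R i)) \<union> near k (Inl (Q i))
      \<union> near k (Inl (Q (nx i))) \<union> near k (Inl (S i))"
    and "near (Suc k) (Inl (S i)) = near k (Inl (S i)) \<union> near k (Inl (R i))"
  unfolding near_def using d_le_Suc_cases[OF _ assms, of "S j" k for j] by auto

lemma near_1:
  assumes "i \<in> I"
  shows "near 1 (Inl (P i)) = {}" "near 1 (Inl (Q i)) = {}"
    "near 1 (Inl (R i)) = {i}" "near 1 (Inl (S i)) = {i}"
  unfolding One_nat_def using assms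
  by (simp_all add: near_Suc near_0)

lemma near_2:
  assumes "i \<in> I"
  shows "near 2 (Inl (P i)) = {}" "near 2 (Inl (Q i)) = {pv i, i}"
    "near 2 (Inl (R i)) = {i}" "near 2 (Inl (S i)) = {i}"
  using assms
  by (simp_all add: near_Suc[where k = 1, unfolded Suc_1] near_1 insert_commute del: One_nat_def)

text \<open>Radius 3 separates \<open>P i\<close> from the edge \<open>P i\<close>,
  \<open>P (nx i)\<close> and \<open>S i\<close> from the edge \<open>R i\<close>,
  \<open>S i\<close>; each of these two pairs agrees up to radius 2.\<close>

lemma near_3:
  assumes "i \<in> I"
  shows "near 3 (Inl (P i)) = {pv i, i}" "near 3 (Inl (R i)) = {pv i, i, nx i}"
    "near 3 (Inl (S i)) = {i}"
  using assms by (auto simp: near_Suc[where k = 2, simplified] near_2)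

section \<open>Identifying elements by their index sets\<close>

lemma elements_cases:
  assumes "y \<in> elements V E"
  obtains i where "i \<in> I" "y = Inl (P i)" | i where "i \<in> I" "y = Inl (Q i)"
  | i where "i \<in> I" "y = Inl (R i)" | i where "i \<in> I" "y = Inl (S i)"
  | i where "i \<in> I" "y = Inr {P i, Q i}" | i where "i \<in> I" "y = Inr {P i, P (nx i)}"
  | i where "i \<in> I" "y = Inr {Q i, Q (nx i)}" | i where "i \<in> I" "y = Inr {R i, Q i}"
  | i where "i \<in> I" "y = Inr {R i, Q (nx i)}" | i where "i \<in> I" "y = Inr {R i, S i}"
  using assms unfolding elements_def E_eq prism_allied_verts_def I_def[symmetric] by blast

lemma near_0_edge:
  assumes "i \<in> I"
  shows "near 0 (Inr {P i, Q i}) = {}" "near 0 (Inr {P i, P (nx i)}) = {}"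
    "near 0 (Inr {Q i, Q (nx i)}) = {}" "near 0 (Inr {R i, Q i}) = {}"
    "near 0 (Inr {R i, Q (nx i)}) = {}" "near 0 (Inr {R i, S i}) = {i}"
  using assms by (simp_all add: near_edge near_0)

lemma near_1_edge:
  assumes "i \<in> I"
  shows "near 1 (Inr {P i, Q i}) = {}" "near 1 (Inr {P i, P (nx i)}) = {}"
    "near 1 (Inr {Q i, Q (nx i)}) = {}" "near 1 (Inr {R i, Q i}) = {i}"
    "near 1 (Inr {R i, Q (nx i)}) = {i}" "near 1 (Inr {R i, S i}) = {i}"
  using assms by (simp_all add: near_edge near_1 del: One_nat_def)

lemma near_2_edge:
  assumes "i \<in> I"
  shows "near 2 (Inr {P i, Q i}) = {pv i, i}" "near 2 (Inr {P i, P (nx i)}) = {}"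
    "near 2 (Inr {Q i, Q (nx i)}) = {pv i, i, nx i}" "near 2 (Inr {R i, Q i}) = {pv i, i}"
    "near 2 (Inr {R i, Q (nx i)}) = {i, nx i}" "near 2 (Inr {R i, S i}) = {i}"
  using assms by (auto simp add: near_edge near_2)

lemma near_3_edge:
  assumes "i \<in> I"
  shows "near 3 (Inr {P i, P (nx i)}) = {pv i, i, nx i}"
    "near 3 (Inr {R i, S i}) = {pv i, i, nx i}"
  using assms by (auto simp add: near_edge near_3)

lemmas near_simps = near_0 near_1 near_2 near_3 near_0_edge near_1_edge near_2_edge near_3_edge

text \<open>A table comparison over radii 0 to 3. The exceptional pair is a genuine tie at every
  radius, by \<open>S_Q_le_S_P\<close>.\<close>

lemma near_eq_imp:
  assumes y: "y1 \<in> elements V E" "y2 \<in> elements V E"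
    and near: "\<And>k. near k y1 = near k y2"
  shows "y1 = y2 \<or> (\<exists>i\<in>I. {y1, y2} = {Inl (Q i), Inr {P i, Q i}})"
proof -
  note near4 = near[of 0] near[of 1] near[of 2] near[of 3]
  \<comment> \<open>One index suffices here: where these sets are compared, a smaller radius has
    already given equal singletons and so equal indices.\<close>
  have neq: "{pv i, i} \<noteq> {i}" "{i, nx i} \<noteq> {i}" "{i, nx i} \<noteq> {pv i, i}"
    "{pv i, i, nx i} \<noteq> {i}" if "i \<in> I" for i
    using cyclic_distinct[OF that] by blast+
  have inj: "{i} = {j} \<longleftrightarrow> i = j" "{pv i, i} = {pv j, j} \<longleftrightarrow> i = j"
    "{pv i, i, nx i} = {pv j, j, nx j} \<longleftrightarrow> i = j" if "i \<in> I" "j \<in> I" for i j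
    using pair_inj[OF that] triple_inj[OF that] by blast+
  show ?thesis
    using near4
    \<comment> \<open>Each of the hundred combinations of element types either has contradictory
      sets at some radius, or yields equal indices and thus one of the two alternatives.\<close>
    by - (rule elements_cases[OF y(1)]; rule elements_cases[OF y(2)]; hypsubst_thin;
        simp only: near_simps simp_thms insert_not_empty empty_not_insert
          inj neq neq[symmetric] pair_neq_triple pair_neq_triple[symmetric];
        blast)
qed

lemma generator:
  "mixed_metric_generator V E (insert (P 1) (S ` I))"
  unfolding mixed_metric_generator_def
proof (intro conjI ballI impI)
  have 1: "1 \<in> I" using n_ge_4 by (simp add: I_def)
  then show "insert (P 1) (S ` I) \<subseteq> V" by auto
  fix y1 y2 assume y: "y1 \<in> elements V E" "y2 \<in> elements V E" "y1 \<noteq> y2"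
  show "\<exists>z\<in>insert (P 1) (S ` I). elem_dist V E z y1 \<noteq> elem_dist V E z y2"
  proof (rule ccontr)
    assume "\<not> ?thesis"
    then have eq: "elem_dist V E z y1 = elem_dist V E z y2" if "z \<in> insert (P 1) (S ` I)" for z
      using that by blast
    \<comment> \<open>Only the pendant vertices are used here; \<open>P 1\<close> is kept for the
      remaining tie.\<close>
    then have "near k y1 = near k y2" for k by (auto simp: near_def)
    then obtain i where i: "i \<in> I" "{y1, y2} = {Inl (Q i), Inr {P i, Q i}}"
      using near_eq_imp y by blast
    then have "d (P 1) (Q i) = min (d (P 1) (P i)) (d (P 1) (Q i))"
      using eq[of "P 1"] by (auto simp: doubleton_eq_iff edge_dist_doubleton)
    then show False using P_P_less_P_Q[OF 1 i(1)] by simp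
  qed
qed

end

theorem theorem5:
  fixes n :: nat
  assumes "n \<ge> 4"
  shows "mdim (prism_allied_verts n) (prism_allied_edges n) = n + 1"
proof -
  interpret prism_allied n by unfold_locales (rule assms)
  have "card (insert (P 1) (S ` I)) = n + 1"
    using card_S by (subst card_insert_disjoint) (auto simp: I_def)
  moreover have "finite (insert (P 1) (S ` I))" by (simp add: I_def)
  ultimately show ?thesis unfolding mdim_def
    using generator by (intro Least_equality) (blast, auto dest: generator_card)
qed

end
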